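(* Let $\theta:(0,\infty)\to\mathbb{R}$ satisfy $0<\theta(x)\le 2\arctan(x/2)$ for all $x>0$. Let $\Lambda\ge0$, $m>0$, $\Delta t>0$ with $\Delta t^2\Lambda/m<4$, let $n\ge1$ be an integer, $m_n=m/n$, $\beta>0$, and $\omega>0$. Put $\vartheta=\theta(\omega\Delta t)$ and $$A=\cos\vartheta-\frac{\Delta t^2(\Lambda/m)}{2}\frac{\sin\vartheta}{\omega\Delta t}.$$ Define the $2\times2$ real matrices $$S^{1/2}=\begin{bmatrix}\cos(\vartheta/2)&\sin(\vartheta/2)/\omega\\-\omega\sin(\vartheta/2)&\cos(\vartheta/2)\end{bmatrix},\qquad B^{1/2}=\begin{bmatrix}1&0\\-\Delta t(\Lambda/m)/2&1\end{bmatrix},$$ $$M=B^{1/2}S^{1/2}\begin{bmatrix}1&0\\0&0\end{bmatrix}S^{1/2}B^{1/2},\qquad R=\frac{1}{\beta m_n}B^{1/2}S^{1/2}\begin{bmatrix}0&0\\0&1\end{bmatrix}(B^{1/2}S^{1/2})^{\mathrm T},$$ and consider the Markov chain on $\mathbb{R}^2$ $$\begin{bmatrix}\varrho^{(k)}\\\varphi^{(k)}\end{bmatrix}=M\begin{bmatrix}\varrho^{(k-1)}\\\varphi^{(k-1)}\end{bmatrix}+R^{1/2}\begin{bmatrix}\xi^{(k-1)}\\\eta^{(k-1)}\end{bmatrix},\quad k\ge1,$$ where all $\xi^{(k)},\eta^{(k)}$ are independent standard normal random variables independent of the initial condition. For a probability distribution $\mu$ on $\mathbb{R}$, let $\mu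 p^k$ denote the law of $\varrho^{(k)}$ when $\varrho^{(0)}\sim\mu$ and, independently, $\varphi^{(0)}\sim\mathcal N(0,(\beta m_n)^{-1})$. Then for all integers $k>1$ and all probability distributions $\mu,\nu$ on $\mathbb{R}$, $$\mathcal W_2(\mu p^k,\nu p^k)\le\begin{cases}A^{k-1}\,\mathcal W_2(\mu,\nu)&\text{if }A>0,\\[2pt] \dfrac12\,\dfrac1{k-1}\,\mathcal W_2(\mu,\nu)&\text{otherwise.}\end{cases}$$
   Context: For probability distributions $\mu,\nu$ on $\mathbb{R}$, the $2$-Wasserstein distance is $\mathcal W_2(\mu,\nu)=\big(\inf\mathbb E|X-Y|^2\big)^{1/2}$, the infimum over all couplings $(X,Y)$ with $X\sim\mu$, $Y\sim\nu$ (possibly $+\infty$). $R^{1/2}$ denotes a matrix square root of the positive semidefinite matrix $R$. This chain is the infinite-friction limit of a BAOAB-type thermostatted ring-polymer integrator for one normal mode of frequency $\omega$ in the harmonic potential $V(q)=(\Lambda/2)q^2$. *)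

theory Defs
  imports "HOL-Probability.Probability"
begin

section \<open>2x2 matrices of the integrator\<close>

definition mat2 :: "real \<Rightarrow> real \<Rightarrow> real \<Rightarrow> real \<Rightarrow> real^2^2" where
  "mat2 a b c d = vector [vector [a, b], vector [c, d]]"

definition Shalf :: "real \<Rightarrow> real \<Rightarrow> real^2^2" where
  "Shalf th \<omega> = mat2 (cos (th/2)) (sin (th/2) / \<omega>) (- \<omega> * sin (th/2)) (cos (th/2))"

definition Bhalf :: "real \<Rightarrow> real \<Rightarrow> real \<Rightarrow> real^2^2" where
  "Bhalf dt \<Lambda> m = mat2 1 0 (- dt * (\<Lambda>/m) / 2) 1"

definition Mmat :: "real \<Rightarrow> real \<Rightarrow> real \<Rightarrow> real \<Rightarrow> real \<Rightarrow> real^2^2" where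
  "Mmat th \<omega> dt \<Lambda> m =
     Bhalf dt \<Lambda> m ** Shalf th \<omega> ** mat2 1 0 0 0 ** Shalf th \<omega> ** Bhalf dt \<Lambda> m"

definition Rmat :: "real \<Rightarrow> real \<Rightarrow> real \<Rightarrow> real \<Rightarrow> real \<Rightarrow> real \<Rightarrow> real \<Rightarrow> real^2^2" where
  "Rmat th \<omega> dt \<Lambda> m \<beta> mn =
     (1 / (\<beta> * mn)) *\<^sub>R (Bhalf dt \<Lambda> m ** Shalf th \<omega> ** mat2 0 0 0 1
        ** transpose (Bhalf dt \<Lambda> m ** Shalf th \<omega>))"

definition Acoef :: "real \<Rightarrow> real \<Rightarrow> real \<Rightarrow> real \<Rightarrow> real \<Rightarrow> real" where
  "Acoef th \<omega> dt \<Lambda> m = cos th - dt^2 * (\<Lambda>/m) / 2 * (sin th / (\<omega> * dt))"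

section \<open>The Markov chain and its laws\<close>

text \<open>Law of a pair of independent standard normals, as a vector in R^2.\<close>
definition gauss2 :: "(real^2) measure" where
  "gauss2 = distr (density lborel std_normal_density \<Otimes>\<^sub>M density lborel std_normal_density)
                  borel (\<lambda>(a, b). vector [a, b])"

text \<open>One step: x goes to Mm x + Rh (xi, eta) with fresh independent standard normals.\<close>
definition step_kernel :: "real^2^2 \<Rightarrow> real^2^2 \<Rightarrow> real^2 \<Rightarrow> (real^2) measure" where
  "step_kernel Mm Rh x = distr gauss2 borel (\<lambda>z. Mm *v x + Rh *v z)"

primrec chain_law :: "real^2^2 \<Rightarrow> real^2^2 \<Rightarrow> (real^2) measure \<Rightarrow> nat \<Rightarrow> (real^2) measure" where
  "chain_law Mm Rh P0 0 = P0"
| "chain_law Mm Rh P0 (Suc k) = bind (chain_law Mm Rh P0 k) (step_kernel Mm Rh)"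

text \<open>Initial law: rho0 ~ mu and independently phi0 ~ N(0, 1/(beta m_n)) (variance).\<close>
definition init_law :: "real measure \<Rightarrow> real \<Rightarrow> (real^2) measure" where
  "init_law \<mu> bmn = distr (\<mu> \<Otimes>\<^sub>M density lborel (normal_density 0 (sqrt (1 / bmn))))
                        borel (\<lambda>(a, b). vector [a, b])"

text \<open>mu p^k : law of rho^(k).\<close>
definition plaw :: "real^2^2 \<Rightarrow> real^2^2 \<Rightarrow> real \<Rightarrow> real measure \<Rightarrow> nat \<Rightarrow> real measure" where
  "plaw Mm Rh bmn \<mu> k = distr (chain_law Mm Rh (init_law \<mu> bmn) k) borel (\<lambda>v. v $ 1)"

section \<open>2-Wasserstein distance on R\<close>

definition couplings :: "real measure \<Rightarrow> real measure \<Rightarrow> (real \<times> real) measure set" where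
  "couplings \<mu> \<nu> = {\<pi>. prob_space \<pi> \<and> sets \<pi> = sets (borel \<Otimes>\<^sub>M borel)
                       \<and> distr \<pi> borel fst = \<mu> \<and> distr \<pi> borel snd = \<nu>}"

text \<open>Squared distance: inf over couplings of E|X-Y|^2 (possibly infinite).\<close>
definition W2sq :: "real measure \<Rightarrow> real measure \<Rightarrow> ennreal" where
  "W2sq \<mu> \<nu> = (INF \<pi> \<in> couplings \<mu> \<nu>. \<integral>\<^sup>+ p. ennreal ((fst p - snd p)^2) \<partial>\<pi>)"

definition W2 :: "real measure \<Rightarrow> real measure \<Rightarrow> ennreal" where
  "W2 \<mu> \<nu> = (if W2sq \<mu> \<nu> = \<top> then \<top> else ennreal (sqrt (enn2real (W2sq \<mu> \<nu>))))"

end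

theory Submission
  imports Defs
begin

text \<open>
  Run the chains started from \<mu> and \<nu> synchronously: the initial positions are drawn from a
  coupling \<pi> of \<mu> and \<nu>, and both chains share the initial momentum and all later noise.
  The noise then cancels, so the difference of the two states evolves deterministically,
  d_k = M^k d_0 with d_0 = (rho_mu - rho_nu, 0). Since M = B S e_1 e_1^T S B has rank one, M = u w^T with w . u = A and
  u_1 w_1 = (1 + A)/2, the position component of d_k is (1 + A)/2 * A^(k-1) * (rho_mu - rho_nu).
  The bounds on \<theta> and dt^2 \<Lambda>/m < 4 give -1 <= A <= 1, and then |(1 + A)/2 * A^(k-1)| is at
  most A^(k-1) when A > 0 and at most 1/(2(k-1)) otherwise, because (1 - a) a^j <= 1/j on [0,1].
  Taking the infimum over \<pi> yields the bound.
\<close>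

section \<open>Rank-one structure of the one-step matrix\<close>

definition rank_one :: "real^'n \<Rightarrow> real^'m \<Rightarrow> real^'m^'n" where
  "rank_one u w = (\<chi> i j. u $ i * w $ j)"

lemma rank_one_mulv: "rank_one u w *v x = (w \<bullet> x) *\<^sub>R u"
  by (simp add: rank_one_def matrix_vector_mult_def inner_vec_def vec_eq_iff sum_distrib_left mult_ac)

lemma matrix_mult_rank_one: "A ** rank_one u w = rank_one (A *v u) w"
  by (simp add: rank_one_def matrix_matrix_mult_def matrix_vector_mult_def vec_eq_iff
      sum_distrib_left sum_distrib_right mult_ac)

lemma rank_one_matrix_mult: "rank_one u w ** C = rank_one u (w v* C)"
  by (simp add: rank_one_def matrix_matrix_mult_def vector_matrix_mult_def vec_eq_iff
      sum_distrib_left mult_ac)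

lemma funpow_rank_one_mulv:
  "((*v) (rank_one u w) ^^ Suc j) x = ((w \<bullet> u) ^ j * (w \<bullet> x)) *\<^sub>R u"
  by (induction j) (simp_all add: rank_one_mulv)

lemma mat2_mult: "mat2 a b c d ** mat2 e f g h = mat2 (a*e+b*g) (a*f+b*h) (c*e+d*g) (c*f+d*h)"
  by (simp add: mat2_def vec_eq_iff forall_2 matrix_matrix_mult_def sum_2)

lemma mat2_mulv: "mat2 a b c d *v vector [x, y] = vector [a * x + b * y, c * x + d * y]"
  by (simp add: mat2_def vec_eq_iff forall_2 matrix_vector_mult_def sum_2)

lemma vector_mat2_mult: "vector [x, y] v* mat2 a b c d = vector [x * a + y * c, x * b + y * d]"
  by (simp add: mat2_def vec_eq_iff forall_2 vector_matrix_mult_def sum_2)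

lemma inner_vector_2: "vector [a, b] \<bullet> (vector [c, d] :: real^2) = a * c + b * d"
  by (simp add: inner_vec_def sum_2)

lemma mat2_projection: "mat2 1 0 0 0 = rank_one (vector [1, 0]) (vector [1, 0] :: real^2)"
  by (simp add: mat2_def rank_one_def vec_eq_iff forall_2)

lemma Mmat_rank_one:
  "Mmat th \<omega> dt L m = rank_one (Bhalf dt L m ** Shalf th \<omega> *v vector [1, 0])
                                 (vector [1, 0] v* (Shalf th \<omega> ** Bhalf dt L m))"
  unfolding Mmat_def mat2_projection matrix_mult_rank_one rank_one_matrix_mult
  by (simp add: matrix_mul_assoc vector_matrix_mul_assoc)

lemma Acoef_half_angle:
  assumes "\<omega> \<noteq> 0" "dt \<noteq> 0"
  shows "Acoef th \<omega> dt L m = cos (th/2)^2 - sin (th/2)^2 - dt * (L/m) * sin (th/2) * cos (th/2) / \<omega>"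
proof -
  have "cos th = cos (th/2)^2 - sin (th/2)^2" and "sin th = 2 * sin (th/2) * cos (th/2)"
    using cos_double[of "th/2"] sin_double[of "th/2"] by simp_all
  then show ?thesis using assms by (simp add: Acoef_def field_simps power2_eq_square)
qed

lemma Mmat_rank_one_factors:
  assumes "\<omega> \<noteq> 0" "dt \<noteq> 0"
  obtains u w where "Mmat th \<omega> dt L m = rank_one u w" and "w \<bullet> u = Acoef th \<omega> dt L m"
    and "u $ 1 * w $ 1 = (1 + Acoef th \<omega> dt L m) / 2"
proof
  let ?c = "cos (th/2)" and ?s = "sin (th/2)" and ?b = "dt * (L/m) / 2"
  let ?u = "vector [?c, - \<omega> * ?s - ?b * ?c] :: real^2"
  let ?w = "vector [?c - ?b * ?s / \<omega>, ?s / \<omega>] :: real^2"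
  show "Mmat th \<omega> dt L m = rank_one ?u ?w"
    unfolding Mmat_rank_one
    by (simp add: Bhalf_def Shalf_def mat2_mult mat2_mulv vector_mat2_mult algebra_simps)
  have "?s^2 = 1 - ?c^2" by (simp add: sin_squared_eq)
  then show "?w \<bullet> ?u = Acoef th \<omega> dt L m" and "?u $ 1 * ?w $ 1 = (1 + Acoef th \<omega> dt L m) / 2"
    using assms unfolding Acoef_half_angle[OF assms]
    by (simp_all add: inner_vector_2 field_simps power2_eq_square)
qed

lemma funpow_Mmat_position:
  assumes "\<omega> \<noteq> 0" "dt \<noteq> 0"
  shows "((*v) (Mmat th \<omega> dt L m) ^^ Suc j) (vector [t, 0]) $ 1
           = (1 + Acoef th \<omega> dt L m) / 2 * Acoef th \<omega> dt L m ^ j * t"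
proof -
  obtain u w where M: "Mmat th \<omega> dt L m = rank_one u w" and wu: "w \<bullet> u = Acoef th \<omega> dt L m"
    and uw: "u $ 1 * w $ 1 = (1 + Acoef th \<omega> dt L m) / 2"
    using Mmat_rank_one_factors[OF assms] .
  have "w \<bullet> vector [t, 0] = w $ 1 * t"
    by (simp add: inner_vec_def sum_2)
  then show ?thesis
    unfolding M funpow_rank_one_mulv wu uw[symmetric] by (simp add: mult_ac)
qed

lemma Acoef_bounds:
  assumes w: "\<omega> > 0" and dt: "dt > 0" and m: "m > 0" and L: "L \<ge> 0" and stab: "dt^2 * L / m < 4"
    and th: "0 < th" "th \<le> 2 * arctan (\<omega> * dt / 2)"
  shows "-1 \<le> Acoef th \<omega> dt L m" and "Acoef th \<omega> dt L m \<le> 1"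
proof -
  define t where "t = th / 2"
  define q where "q = dt * (L/m) / \<omega>"
  have t: "0 < t" "t \<le> arctan (\<omega> * dt / 2)" using th by (simp_all add: t_def)
  then have "t < pi / 2" using arctan_ubound[of "\<omega> * dt / 2"] by linarith
  then have c: "cos t > 0" and s: "sin t > 0" using t by (simp_all add: cos_gt_zero sin_gt_zero)
  have "tan t \<le> tan (arctan (\<omega> * dt / 2))"
    using t arctan_ubound[of "\<omega> * dt / 2"] by (intro tan_mono_le) auto
  then have "tan t \<le> \<omega> * dt / 2" by (simp only: tan_arctan)
  then have "sin t \<le> \<omega> * dt / 2 * cos t" using c by (simp add: tan_def divide_le_eq)
  moreover have "q \<ge> 0" using w m L dt by (simp add: q_def)
  ultimately have "q * sin t \<le> q * (\<omega> * dt / 2 * cos t)" by (rule mult_left_mono)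
  also have "\<dots> = dt^2 * L / m / 2 * cos t" using w by (simp add: q_def power2_eq_square)
  also have "\<dots> \<le> 2 * cos t" using stab c m by (intro mult_right_mono) (simp_all add: field_simps)
  finally have qs: "q * sin t \<le> 2 * cos t" .
  have A: "Acoef th \<omega> dt L m = 2 * cos t ^ 2 - 1 - q * sin t * cos t"
    using w dt Acoef_half_angle[of \<omega> dt th L m] sin_squared_eq[of "th / 2"]
    by (simp add: t_def q_def field_simps)
  show "-1 \<le> Acoef th \<omega> dt L m"
    using mult_right_mono[OF qs less_imp_le[OF c]] unfolding A by (simp add: power2_eq_square)
  have "0 \<le> q * sin t * cos t" using w dt m L s c by (simp add: q_def)
  moreover have "cos t ^ 2 \<le> 1" using sin_cos_squared_add[of t] zero_le_power2[of "sin t"] by linarith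
  ultimately show "Acoef th \<omega> dt L m \<le> 1" unfolding A by linarith
qed

lemma power_mult_one_plus_le_one:
  fixes a :: real
  assumes "0 \<le> a" "a \<le> 1"
  shows "a ^ j * (1 + real j * (1 - a)) \<le> 1"
proof (induction j)
  case 0 then show ?case by simp
next
  case (Suc j)
  have "a ^ Suc j * (1 + real (Suc j) * (1 - a))
          = a ^ j * (1 + real j * (1 - a)) - a ^ j * (1 - a)^2 * (real j + 1)"
    by (simp add: algebra_simps power2_eq_square)
  also have "\<dots> \<le> a ^ j * (1 + real j * (1 - a))"
    using assms by simp
  finally show ?case using Suc by linarith
qed

lemma contraction_factor_le:
  fixes A :: real
  assumes "-1 \<le> A" "A \<le> 1" "j \<ge> 1"
  shows "\<bar>(1 + A) / 2 * A ^ j\<bar> \<le> (if A > 0 then A ^ j else 1 / 2 * (1 / real j))"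
proof (cases "A > 0")
  case True
  then show ?thesis using assms by (simp add: mult_left_le_one_le)
next
  case False
  define a where "a = - A"
  have a: "0 \<le> a" "a \<le> 1" using False assms by (simp_all add: a_def)
  have "(1 - a) * a ^ j * real j \<le> a ^ j * (1 + real j * (1 - a))"
    using a by (simp add: algebra_simps)
  then have "(1 - a) * a ^ j * real j \<le> 1"
    using power_mult_one_plus_le_one[OF a, of j] by linarith
  then have "(1 - a) * a ^ j \<le> 1 / real j" using assms(3) by (simp add: field_simps)
  moreover have "\<bar>(1 + A) / 2 * A ^ j\<bar> = (1 - a) / 2 * a ^ j"
    using a by (simp add: a_def abs_mult power_abs)
  ultimately show ?thesis using False by simp
qed

section \<open>Synchronous coupling of two chains\<close>

lemma continuous_on_vector_2 [continuous_intros]: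
  assumes "continuous_on S f" "continuous_on S g"
  shows "continuous_on S (\<lambda>x. vector [f x, g x] :: real^2)"
proof -
  have "continuous_on S (\<lambda>x. if i = 1 then f x else g x)" for i :: 2
    using assms by (cases "i = 1") simp_all
  then have "continuous_on S (\<lambda>x. (\<chi> i. if i = 1 then f x else g x) :: real^2)"
    by (rule continuous_on_vec_lambda)
  moreover have "(\<lambda>x. (\<chi> i. if i = 1 then f x else g x) :: real^2) = (\<lambda>x. vector [f x, g x])"
    by (simp add: vec_eq_iff forall_2 fun_eq_iff)
  ultimately show ?thesis by (simp only:)
qed

lemma continuous_on_matrix_vector_mult [continuous_intros]:
  "continuous_on S f \<Longrightarrow> continuous_on S (\<lambda>x. (A :: real^'n^'m) *v f x)"
  using continuous_on_compose2[OF matrix_vector_mult_linear_continuous_on[of UNIV A]] by auto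

lemma measurable_continuous_borel:
  assumes "sets M = sets borel" and "continuous_on UNIV f"
  shows "f \<in> M \<rightarrow>\<^sub>M borel"
  unfolding measurable_cong_sets[OF assms(1) refl] using assms(2) by (rule borel_measurable_continuous_onI)

lemma sets_pair_borel:
  fixes M :: "'a::second_countable_topology measure" and N :: "'b::second_countable_topology measure"
  assumes "sets M = sets borel" "sets N = sets borel"
  shows "sets (M \<Otimes>\<^sub>M N) = sets borel"
  unfolding borel_prod[symmetric] by (rule sets_pair_measure_cong[OF assms])

lemma prob_space_gauss2: "prob_space gauss2"
proof -
  have "prob_space (density lborel std_normal_density)"
    using prob_space_normal_density[of 1 0] by simp
  then interpret pair_prob_space "density lborel std_normal_density" "density lborel std_normal_density"
    by (simp add: pair_prob_space_def pair_sigma_finite_def prob_space_imp_sigma_finite)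
  show ?thesis unfolding gauss2_def case_prod_beta
    by (intro prob_space_distr measurable_continuous_borel sets_pair_borel continuous_intros) simp_all
qed

lemma sets_gauss2: "sets gauss2 = sets borel"
  by (simp add: gauss2_def)

lemma measurable_step_kernel: "step_kernel Mm Rh \<in> borel \<rightarrow>\<^sub>M subprob_algebra borel"
  unfolding step_kernel_def
proof (rule measurable_distr2)
  show "(\<lambda>(x, z). Mm *v x + Rh *v z) \<in> borel \<Otimes>\<^sub>M gauss2 \<rightarrow>\<^sub>M borel"
    unfolding case_prod_beta
    by (intro measurable_continuous_borel sets_pair_borel sets_gauss2 continuous_intros) simp
  show "(\<lambda>x. gauss2) \<in> borel \<rightarrow>\<^sub>M subprob_algebra gauss2"
    by (simp add: prob_space_gauss2 prob_space_imp_subprob_space space_subprob_algebra)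
qed

definition sync_kernel ::
  "real^2^2 \<Rightarrow> real^2^2 \<Rightarrow> (real^2) \<times> (real^2) \<Rightarrow> ((real^2) \<times> (real^2)) measure"
where
  "sync_kernel Mm Rh p = distr gauss2 borel (\<lambda>z. (Mm *v fst p + Rh *v z, Mm *v snd p + Rh *v z))"

lemma measurable_sync_kernel: "sync_kernel Mm Rh \<in> borel \<rightarrow>\<^sub>M subprob_algebra borel"
  unfolding sync_kernel_def
proof (rule measurable_distr2)
  show "(\<lambda>(p, z). (Mm *v fst p + Rh *v z, Mm *v snd p + Rh *v z))
          \<in> borel \<Otimes>\<^sub>M gauss2 \<rightarrow>\<^sub>M borel"
    unfolding case_prod_beta
    by (intro measurable_continuous_borel sets_pair_borel sets_gauss2 continuous_intros) simp
  show "(\<lambda>x. gauss2) \<in> borel \<rightarrow>\<^sub>M subprob_algebra gauss2"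
    by (simp add: prob_space_gauss2 prob_space_imp_subprob_space space_subprob_algebra)
qed

lemma prob_space_sync_kernel: "prob_space (sync_kernel Mm Rh p)"
  unfolding sync_kernel_def
  by (intro prob_space.prob_space_distr prob_space_gauss2 measurable_continuous_borel sets_gauss2
      continuous_intros)

lemma distr_sync_kernel:
  shows distr_sync_kernel_fst: "distr (sync_kernel Mm Rh p) borel fst = step_kernel Mm Rh (fst p)"
    and distr_sync_kernel_snd: "distr (sync_kernel Mm Rh p) borel snd = step_kernel Mm Rh (snd p)"
proof -
  have noise: "(\<lambda>z. (Mm *v fst p + Rh *v z, Mm *v snd p + Rh *v z)) \<in> gauss2 \<rightarrow>\<^sub>M borel"
    by (intro measurable_continuous_borel sets_gauss2 continuous_intros)
  have "fst \<in> borel \<rightarrow>\<^sub>M (borel :: (real^2) measure)" "snd \<in> borel \<rightarrow>\<^sub>M (borel :: (real^2) measure)"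
    by (intro measurable_continuous_borel continuous_intros; simp)+
  from this[THEN distr_distr, OF noise]
  show "distr (sync_kernel Mm Rh p) borel fst = step_kernel Mm Rh (fst p)"
    and "distr (sync_kernel Mm Rh p) borel snd = step_kernel Mm Rh (snd p)"
    unfolding sync_kernel_def step_kernel_def by (simp_all add: comp_def)
qed

primrec sync_chain ::
  "real^2^2 \<Rightarrow> real^2^2 \<Rightarrow> ((real^2) \<times> (real^2)) measure \<Rightarrow> nat \<Rightarrow> ((real^2) \<times> (real^2)) measure"
where
  "sync_chain Mm Rh Q0 0 = Q0"
| "sync_chain Mm Rh Q0 (Suc k) = sync_chain Mm Rh Q0 k \<bind> sync_kernel Mm Rh"

lemma prob_space_sync_chain:
  assumes "prob_space Q0" "sets Q0 = sets borel"
  shows "prob_space (sync_chain Mm Rh Q0 k) \<and> sets (sync_chain Mm Rh Q0 k) = sets borel"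
proof (induction k)
  case 0
  show ?case using assms by simp
next
  case (Suc k)
  then have "prob_space (sync_chain Mm Rh Q0 k)" and sets: "sets (sync_chain Mm Rh Q0 k) = sets borel"
    by simp_all
  then interpret prob_space "sync_chain Mm Rh Q0 k" by simp
  have K: "sync_kernel Mm Rh \<in> sync_chain Mm Rh Q0 k \<rightarrow>\<^sub>M subprob_algebra borel"
    using measurable_sync_kernel unfolding measurable_cong_sets[OF sets refl] .
  have "prob_space (sync_chain Mm Rh Q0 k \<bind> sync_kernel Mm Rh)"
    by (rule prob_space_bind[OF _ K]) (simp add: prob_space_sync_kernel)
  moreover have "sets (sync_chain Mm Rh Q0 k \<bind> sync_kernel Mm Rh) = sets borel"
    by (rule sets_bind_measurable[OF K not_empty])
  ultimately show ?case by simp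
qed

lemma distr_sync_chain:
  assumes Q0: "prob_space Q0" "sets Q0 = sets borel"
    and f: "f \<in> borel_measurable borel"
    and f_kernel: "\<And>p. distr (sync_kernel Mm Rh p) borel f = step_kernel Mm Rh (f p)"
  shows "distr (sync_chain Mm Rh Q0 k) borel f = chain_law Mm Rh (distr Q0 borel f) k"
proof (induction k)
  case 0
  show ?case by simp
next
  case (Suc k)
  let ?Q = "sync_chain Mm Rh Q0 k"
  have "prob_space ?Q" and sets: "sets ?Q = sets borel"
    using prob_space_sync_chain[OF Q0] by simp_all
  then have ne: "space ?Q \<noteq> {}" by (simp add: prob_space.not_empty)
  have K: "sync_kernel Mm Rh \<in> ?Q \<rightarrow>\<^sub>M subprob_algebra borel"
    using measurable_sync_kernel unfolding measurable_cong_sets[OF sets refl] .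
  have fQ: "f \<in> ?Q \<rightarrow>\<^sub>M borel"
    using f unfolding measurable_cong_sets[OF sets refl] .
  have "distr (?Q \<bind> sync_kernel Mm Rh) borel f = ?Q \<bind> (\<lambda>p. distr (sync_kernel Mm Rh p) borel f)"
    by (rule distr_bind[OF K ne f])
  also have "\<dots> = distr ?Q borel f \<bind> step_kernel Mm Rh"
    unfolding f_kernel by (rule bind_distr[OF fQ measurable_step_kernel ne, symmetric])
  finally show ?case using Suc by simp
qed

lemma nn_integral_sync_chain_diff:
  assumes Q0: "prob_space Q0" "sets Q0 = sets borel" and g: "g \<in> borel_measurable borel"
  shows "(\<integral>\<^sup>+p. g (fst p - snd p) \<partial>sync_chain Mm Rh Q0 k)
           = (\<integral>\<^sup>+p. g (((*v) Mm ^^ k) (fst p - snd p)) \<partial>Q0)"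
  using g
proof (induction k arbitrary: g)
  case 0
  show ?case by simp
next
  case (Suc k)
  let ?Q = "sync_chain Mm Rh Q0 k"
  have sets: "sets ?Q = sets borel"
    using prob_space_sync_chain[OF Q0] by simp
  have K: "sync_kernel Mm Rh \<in> ?Q \<rightarrow>\<^sub>M subprob_algebra borel"
    using measurable_sync_kernel unfolding measurable_cong_sets[OF sets refl] .
  have g_diff: "(\<lambda>p. g (fst p - snd p)) \<in> borel_measurable borel"
    by (rule measurable_compose[OF _ Suc.prems]) (intro measurable_continuous_borel continuous_intros; simp)
  have g_Mm: "(\<lambda>v. g (Mm *v v)) \<in> borel_measurable borel"
    by (rule measurable_compose[OF _ Suc.prems]) (intro measurable_continuous_borel continuous_intros; simp)
  have step: "(\<integral>\<^sup>+q. g (fst q - snd q) \<partial>sync_kernel Mm Rh p) = g (Mm *v (fst p - snd p))" for p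
  proof -
    have noise: "(\<lambda>z. (Mm *v fst p + Rh *v z, Mm *v snd p + Rh *v z)) \<in> gauss2 \<rightarrow>\<^sub>M borel"
      by (intro measurable_continuous_borel sets_gauss2 continuous_intros)
    have "(\<integral>\<^sup>+q. g (fst q - snd q) \<partial>sync_kernel Mm Rh p)
            = (\<integral>\<^sup>+z. g (Mm *v fst p + Rh *v z - (Mm *v snd p + Rh *v z)) \<partial>gauss2)"
      unfolding sync_kernel_def using g_diff by (simp add: nn_integral_distr[OF noise])
    also have "\<dots> = g (Mm *v (fst p - snd p))"
      by (simp add: matrix_vector_mult_diff_distrib prob_space.emeasure_space_1[OF prob_space_gauss2])
    finally show ?thesis .
  qed
  have "(\<integral>\<^sup>+p. g (fst p - snd p) \<partial>?Q \<bind> sync_kernel Mm Rh)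
          = (\<integral>\<^sup>+p. g (Mm *v (fst p - snd p)) \<partial>?Q)"
    by (simp add: nn_integral_bind[OF g_diff K] step)
  also have "\<dots> = (\<integral>\<^sup>+p. g (((*v) Mm ^^ Suc k) (fst p - snd p)) \<partial>Q0)"
    using Suc.IH[OF g_Mm] by simp
  finally show ?case by simp
qed

lemma couplingsD:
  assumes "\<pi> \<in> couplings \<mu> \<nu>"
  shows "prob_space \<pi>" "sets \<pi> = sets borel" "distr \<pi> borel fst = \<mu>" "distr \<pi> borel snd = \<nu>"
  using assms unfolding couplings_def borel_prod by simp_all

lemma distr_pair_measure_vector_2:
  fixes \<pi> :: "'a::second_countable_topology measure"
  assumes sets_\<pi>: "sets \<pi> = sets borel" and N: "prob_space N" "sets N = sets borel"
    and h: "h \<in> borel_measurable borel"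
  shows "distr (\<pi> \<Otimes>\<^sub>M N) borel (\<lambda>p. vector [h (fst p), snd p] :: real^2)
           = distr (distr \<pi> borel h \<Otimes>\<^sub>M N) borel (\<lambda>(a, c). vector [a, c])"
proof -
  have h\<pi>: "h \<in> \<pi> \<rightarrow>\<^sub>M borel" using h unfolding measurable_cong_sets[OF sets_\<pi> refl] .
  have idN: "(\<lambda>c. c) \<in> N \<rightarrow>\<^sub>M borel" using N(2) by (rule measurable_ident_sets)
  have "distr N borel (\<lambda>c. c) = N" using N(2)[symmetric] by (rule distr_id2)
  then have prod: "distr \<pi> borel h \<Otimes>\<^sub>M N = distr (\<pi> \<Otimes>\<^sub>M N) (borel \<Otimes>\<^sub>M borel) (\<lambda>(x, c). (h x, c))"
    using pair_measure_distr[OF h\<pi> idN] N(1) by (simp add: prob_space_imp_sigma_finite)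
  have "(\<lambda>(x, c). (h x, c)) \<in> \<pi> \<Otimes>\<^sub>M N \<rightarrow>\<^sub>M borel \<Otimes>\<^sub>M borel"
    unfolding case_prod_beta
    by (intro measurable_Pair measurable_compose[OF measurable_fst h\<pi>] measurable_compose[OF measurable_snd idN])
  moreover have "(\<lambda>(a, c). vector [a, c] :: real^2) \<in> borel \<Otimes>\<^sub>M borel \<rightarrow>\<^sub>M borel"
    unfolding borel_prod case_prod_beta by (intro measurable_continuous_borel continuous_intros) simp
  ultimately show ?thesis
    unfolding prod by (subst distr_distr) (simp_all add: comp_def case_prod_beta)
qed

definition init_coupling :: "(real \<times> real) measure \<Rightarrow> real \<Rightarrow> ((real^2) \<times> (real^2)) measure"
where
  "init_coupling \<pi> bmn = distr (\<pi> \<Otimes>\<^sub>M density lborel (normal_density 0 (sqrt (1 / bmn)))) borel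
     (\<lambda>(x, c). (vector [fst x, c], vector [snd x, c]))"

lemma
  assumes \<pi>: "\<pi> \<in> couplings \<mu> \<nu>" and bmn: "bmn > 0"
  shows prob_space_init_coupling: "prob_space (init_coupling \<pi> bmn)"
    and sets_init_coupling: "sets (init_coupling \<pi> bmn) = sets borel"
    and distr_init_coupling_fst: "distr (init_coupling \<pi> bmn) borel fst = init_law \<mu> bmn"
    and distr_init_coupling_snd: "distr (init_coupling \<pi> bmn) borel snd = init_law \<nu> bmn"
    and nn_integral_init_coupling_diff: "h \<in> borel_measurable borel \<Longrightarrow>
          (\<integral>\<^sup>+p. h (fst p - snd p) \<partial>init_coupling \<pi> bmn)
            = (\<integral>\<^sup>+x. h (vector [fst x - snd x, 0]) \<partial>\<pi>)"
proof -
  define N where "N = density lborel (\<lambda>x. ennreal (normal_density 0 (sqrt (1 / bmn)) x))"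
  have N: "prob_space N" "sets N = sets borel"
    unfolding N_def by (rule prob_space_normal_density) (use bmn in simp_all)
  interpret pair_prob_space \<pi> N
    using couplingsD(1)[OF \<pi>] N(1)
    by (simp add: pair_prob_space_def pair_sigma_finite_def prob_space_imp_sigma_finite)
  have sets_\<pi>N: "sets (\<pi> \<Otimes>\<^sub>M N) = sets borel"
    by (rule sets_pair_borel[OF couplingsD(2)[OF \<pi>] N(2)])
  have F: "(\<lambda>(x, c). (vector [fst x, c], vector [snd x, c]) :: (real^2) \<times> (real^2))
             \<in> \<pi> \<Otimes>\<^sub>M N \<rightarrow>\<^sub>M borel"
    unfolding case_prod_beta by (intro measurable_continuous_borel[OF sets_\<pi>N] continuous_intros)
  then show "prob_space (init_coupling \<pi> bmn)"
    unfolding init_coupling_def N_def[symmetric] by (rule prob_space_distr)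
  show "sets (init_coupling \<pi> bmn) = sets borel" by (simp add: init_coupling_def)
  have "fst \<in> borel \<rightarrow>\<^sub>M (borel :: (real^2) measure)" "snd \<in> borel \<rightarrow>\<^sub>M (borel :: (real^2) measure)"
    by (intro measurable_continuous_borel continuous_intros; simp)+
  from this[THEN distr_distr, OF F]
  have init:
    "distr (init_coupling \<pi> bmn) borel fst = distr (\<pi> \<Otimes>\<^sub>M N) borel (\<lambda>p. vector [fst (fst p), snd p])"
    "distr (init_coupling \<pi> bmn) borel snd = distr (\<pi> \<Otimes>\<^sub>M N) borel (\<lambda>p. vector [snd (fst p), snd p])"
    unfolding init_coupling_def N_def[symmetric] by (simp_all add: comp_def case_prod_beta)
  have "fst \<in> borel_measurable (borel :: (real \<times> real) measure)"
    and "snd \<in> borel_measurable (borel :: (real \<times> real) measure)"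
    by (intro measurable_continuous_borel continuous_intros; simp)+
  note marginal = this[THEN distr_pair_measure_vector_2[OF couplingsD(2)[OF \<pi>] N]]
  show "distr (init_coupling \<pi> bmn) borel fst = init_law \<mu> bmn"
    unfolding init(1) marginal(1) couplingsD(3)[OF \<pi>] by (simp add: init_law_def N_def)
  show "distr (init_coupling \<pi> bmn) borel snd = init_law \<nu> bmn"
    unfolding init(2) marginal(2) couplingsD(4)[OF \<pi>] by (simp add: init_law_def N_def)
  assume h: "h \<in> borel_measurable borel"
  have "(\<lambda>p. h (fst p - snd p)) \<in> borel_measurable borel"
    by (rule measurable_compose[OF _ h]) (intro measurable_continuous_borel continuous_intros; simp)
  moreover have "vector [a, c] - vector [b, c] = (vector [a - b, 0] :: real^2)" for a b c
    by (simp add: vec_eq_iff forall_2)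
  ultimately have "(\<integral>\<^sup>+p. h (fst p - snd p) \<partial>init_coupling \<pi> bmn)
                     = (\<integral>\<^sup>+q. h (vector [fst (fst q) - snd (fst q), 0]) \<partial>(\<pi> \<Otimes>\<^sub>M N))"
    unfolding init_coupling_def N_def[symmetric] by (simp add: nn_integral_distr[OF F] case_prod_beta)
  also have "\<dots> = (\<integral>\<^sup>+x. \<integral>\<^sup>+c. h (vector [fst x - snd x, 0]) \<partial>N \<partial>\<pi>)"
  proof -
    have "(\<lambda>x. h (vector [fst x - snd x, 0])) \<in> \<pi> \<rightarrow>\<^sub>M borel"
      by (rule measurable_compose[OF _ h])
        (intro measurable_continuous_borel[OF couplingsD(2)[OF \<pi>]] continuous_intros)
    from M2.nn_integral_fst[OF measurable_compose[OF measurable_fst this]] show ?thesis by simp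
  qed
  also have "\<dots> = (\<integral>\<^sup>+x. h (vector [fst x - snd x, 0]) \<partial>\<pi>)"
    by (simp add: M2.emeasure_space_1)
  finally show "(\<integral>\<^sup>+p. h (fst p - snd p) \<partial>init_coupling \<pi> bmn)
                  = (\<integral>\<^sup>+x. h (vector [fst x - snd x, 0]) \<partial>\<pi>)" .
qed

definition transport_cost :: "(real \<times> real) measure \<Rightarrow> ennreal" where
  "transport_cost \<pi> = (\<integral>\<^sup>+p. ennreal ((fst p - snd p)^2) \<partial>\<pi>)"

lemma coupling_first_coordinates:
  fixes Q :: "((real^2) \<times> (real^2)) measure"
  assumes Q: "prob_space Q" "sets Q = sets borel"
  shows "distr Q borel (\<lambda>p. (fst p $ 1, snd p $ 1))
           \<in> couplings (distr (distr Q borel fst) borel (\<lambda>v. v $ 1))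
                        (distr (distr Q borel snd) borel (\<lambda>v. v $ 1))"
proof -
  have G: "(\<lambda>p. (fst p $ 1, snd p $ 1)) \<in> Q \<rightarrow>\<^sub>M borel"
    by (intro measurable_continuous_borel[OF Q(2)] continuous_intros)
  have fst: "fst \<in> Q \<rightarrow>\<^sub>M (borel :: (real^2) measure)" "fst \<in> borel \<rightarrow>\<^sub>M (borel :: real measure)"
    and snd: "snd \<in> Q \<rightarrow>\<^sub>M (borel :: (real^2) measure)" "snd \<in> borel \<rightarrow>\<^sub>M (borel :: real measure)"
    and coord: "(\<lambda>v. v $ 1) \<in> borel \<rightarrow>\<^sub>M (borel :: real measure)"
    by (intro measurable_continuous_borel[OF Q(2)] measurable_continuous_borel continuous_intros; simp)+
  show ?thesis
    unfolding couplings_def borel_prod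
    by (simp add: prob_space.prob_space_distr[OF Q(1) G] distr_distr[OF fst(2) G] distr_distr[OF snd(2) G]
        distr_distr[OF coord fst(1)] distr_distr[OF coord snd(1)] comp_def)
qed

lemma coupling_plaw:
  assumes \<pi>: "\<pi> \<in> couplings \<mu> \<nu>" and bmn: "bmn > 0"
    and position: "\<And>t. ((*v) Mm ^^ k) (vector [t, 0]) $ 1 = C * t"
  shows "\<exists>\<rho>\<in>couplings (plaw Mm Rh bmn \<mu> k) (plaw Mm Rh bmn \<nu> k).
           transport_cost \<rho> = ennreal (C^2) * transport_cost \<pi>"
proof -
  let ?Q\<^sub>0 = "init_coupling \<pi> bmn"
  let ?Q = "sync_chain Mm Rh ?Q\<^sub>0 k"
  define \<rho> where "\<rho> = distr ?Q borel (\<lambda>p. (fst p $ 1, snd p $ 1))"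
  note Q0 = prob_space_init_coupling[OF \<pi> bmn] sets_init_coupling[OF \<pi> bmn]
  have Q: "prob_space ?Q" "sets ?Q = sets borel"
    using prob_space_sync_chain[OF Q0] by simp_all
  have fst: "fst \<in> borel \<rightarrow>\<^sub>M (borel :: (real^2) measure)"
    and snd: "snd \<in> borel \<rightarrow>\<^sub>M (borel :: (real^2) measure)"
    by (intro measurable_continuous_borel continuous_intros; simp)+
  note chain = distr_sync_chain[OF Q0 fst distr_sync_kernel_fst] distr_sync_chain[OF Q0 snd distr_sync_kernel_snd]
  have "\<rho> \<in> couplings (plaw Mm Rh bmn \<mu> k) (plaw Mm Rh bmn \<nu> k)"
    using coupling_first_coordinates[OF Q, folded \<rho>_def]
    unfolding plaw_def chain distr_init_coupling_fst[OF \<pi> bmn] distr_init_coupling_snd[OF \<pi> bmn] .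
  moreover have "transport_cost \<rho> = ennreal (C^2) * transport_cost \<pi>"
  proof -
    define h where "h = (\<lambda>v::real^2. ennreal ((v $ 1)^2))"
    have h: "h \<in> borel_measurable borel"
      unfolding h_def
      by (intro measurable_compose[OF _ measurable_ennreal] measurable_continuous_borel continuous_intros) simp
    have mulv: "(*v) Mm \<in> borel \<rightarrow>\<^sub>M borel"
      by (intro measurable_continuous_borel continuous_intros) simp
    have "(\<lambda>p. (fst p $ 1, snd p $ 1)) \<in> ?Q \<rightarrow>\<^sub>M borel"
      by (intro measurable_continuous_borel[OF Q(2)] continuous_intros)
    moreover have "(\<lambda>p. ennreal ((fst p - snd p)^2)) \<in> borel_measurable (borel :: (real \<times> real) measure)"
      by (intro measurable_compose[OF _ measurable_ennreal] measurable_continuous_borel continuous_intros) simp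
    ultimately have "transport_cost \<rho> = (\<integral>\<^sup>+q. h (fst q - snd q) \<partial>?Q)"
      by (simp add: \<rho>_def transport_cost_def h_def nn_integral_distr)
    also have "\<dots> = (\<integral>\<^sup>+p. h (((*v) Mm ^^ k) (fst p - snd p)) \<partial>?Q\<^sub>0)"
      by (rule nn_integral_sync_chain_diff[OF Q0 h])
    also have "\<dots> = (\<integral>\<^sup>+x. h (((*v) Mm ^^ k) (vector [fst x - snd x, 0])) \<partial>\<pi>)"
      by (rule nn_integral_init_coupling_diff[OF \<pi> bmn measurable_compose[OF measurable_compose_n[OF mulv] h]])
    also have "\<dots> = (\<integral>\<^sup>+x. ennreal (C^2) * ennreal ((fst x - snd x)^2) \<partial>\<pi>)"
      by (simp add: h_def position power_mult_distrib ennreal_mult')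
    also have "\<dots> = ennreal (C^2) * transport_cost \<pi>"
      unfolding transport_cost_def
      by (rule nn_integral_cmult) (intro measurable_compose[OF _ measurable_ennreal]
          measurable_continuous_borel[OF couplingsD(2)[OF \<pi>]] continuous_intros)
    finally show ?thesis .
  qed
  ultimately show ?thesis by blast
qed

section \<open>Transfer to the Wasserstein distance\<close>

lemma ennreal_mult_INF:
  fixes c :: ennreal
  assumes "c < top" "S \<noteq> {}"
  shows "c * (INF x\<in>S. f x) = (INF x\<in>S. c * f x)"
proof -
  have "mono ((*) c)" by (intro monoI mult_left_mono) auto
  moreover have "continuous (at_right (INF x\<in>S. f x)) ((*) c)"
    using ennreal_continuous_on_cmult[OF assms(1) continuous_on_id]
    by (simp add: continuous_on_eq_continuous_within continuous_at_imp_continuous_at_within)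
  ultimately show ?thesis
    using continuous_at_Inf_mono[of "(*) c" "f ` S"] assms(2) by (simp add: image_image)
qed

lemma W2_le_cmult:
  assumes C: "\<bar>C\<bar> \<le> c" "0 < c"
    and transfer: "\<And>\<pi>. \<pi> \<in> couplings \<mu> \<nu> \<Longrightarrow>
             \<exists>\<rho>\<in>couplings P P'. transport_cost \<rho> = ennreal (C^2) * transport_cost \<pi>"
  shows "W2 P P' \<le> ennreal c * W2 \<mu> \<nu>"
proof (cases "W2sq \<mu> \<nu> = \<top>")
  case True
  then show ?thesis using C(2) by (simp add: W2_def ennreal_mult_top)
next
  case False
  then have ne: "couplings \<mu> \<nu> \<noteq> {}" by (auto simp: W2sq_def)
  define X where "X = enn2real (W2sq \<mu> \<nu>)"
  have X: "W2sq \<mu> \<nu> = ennreal X" "X \<ge> 0" using False by (simp_all add: X_def ennreal_enn2real_if)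
  have "W2sq P P' \<le> (INF \<pi>\<in>couplings \<mu> \<nu>. ennreal (C^2) * transport_cost \<pi>)"
  proof (rule INF_greatest)
    fix \<pi> assume "\<pi> \<in> couplings \<mu> \<nu>"
    with transfer obtain \<rho> where \<rho>: "\<rho> \<in> couplings P P'"
      and cost: "transport_cost \<rho> = ennreal (C^2) * transport_cost \<pi>"
      by blast
    have "W2sq P P' \<le> transport_cost \<rho>"
      using \<rho> unfolding W2sq_def transport_cost_def by (rule INF_lower)
    then show "W2sq P P' \<le> ennreal (C^2) * transport_cost \<pi>" unfolding cost .
  qed
  also have "\<dots> = ennreal (C^2 * X)"
    using ne X by (simp add: ennreal_mult_INF[symmetric] W2sq_def transport_cost_def ennreal_mult)
  finally have "W2sq P P' \<le> ennreal (C^2 * X)" .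
  then have "W2sq P P' \<noteq> \<top>" and "enn2real (W2sq P P') \<le> C^2 * X"
    using X(2) by (auto simp: top_unique enn2real_leI)
  then have "W2 P P' \<le> ennreal (sqrt (C^2 * X))"
    unfolding W2_def by (simp add: ennreal_leI real_sqrt_le_mono)
  also have "\<dots> \<le> ennreal (c * sqrt X)"
    using C X(2) by (simp add: real_sqrt_mult mult_right_mono)
  also have "\<dots> = ennreal c * W2 \<mu> \<nu>"
    using False C(2) X by (simp add: W2_def ennreal_mult)
  finally show ?thesis .
qed

theorem theorem3:
  fixes \<theta> :: "real \<Rightarrow> real" and \<Lambda> m dt \<beta> \<omega> :: real and n k :: nat
    and \<mu> \<nu> :: "real measure" and Rh :: "real^2^2"
  assumes theta: "\<forall>x>0. 0 < \<theta> x \<and> \<theta> x \<le> 2 * arctan (x / 2)"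
    and Lam: "\<Lambda> \<ge> 0" and mpos: "m > 0" and dtpos: "dt > 0" and stab: "dt^2 * \<Lambda> / m < 4"
    and npos: "n \<ge> 1" and bpos: "\<beta> > 0" and wpos: "\<omega> > 0"
    and Rh_sym: "transpose Rh = Rh"
    and Rh_psd: "\<forall>v. 0 \<le> v \<bullet> (Rh *v v)"
    and Rh_sq: "Rh ** Rh = Rmat (\<theta> (\<omega> * dt)) \<omega> dt \<Lambda> m \<beta> (m / real n)"
    and k: "k > 1"
    and mu: "prob_space \<mu>" "sets \<mu> = sets borel"
    and nu: "prob_space \<nu>" "sets \<nu> = sets borel"
  shows "W2 (plaw (Mmat (\<theta> (\<omega> * dt)) \<omega> dt \<Lambda> m) Rh (\<beta> * (m / real n)) \<mu> k)
            (plaw (Mmat (\<theta> (\<omega> * dt)) \<omega> dt \<Lambda> m) Rh (\<beta> * (m / real n)) \<nu> k)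
         \<le> ennreal (if Acoef (\<theta> (\<omega> * dt)) \<omega> dt \<Lambda> m > 0
                     then Acoef (\<theta> (\<omega> * dt)) \<omega> dt \<Lambda> m ^ (k - 1)
                     else 1 / 2 * (1 / real (k - 1))) * W2 \<mu> \<nu>"
proof -
  define th where "th = \<theta> (\<omega> * dt)"
  define A where "A = Acoef th \<omega> dt \<Lambda> m"
  have th: "0 < th" "th \<le> 2 * arctan (\<omega> * dt / 2)"
    using theta wpos dtpos by (simp_all add: th_def)
  have A: "-1 \<le> A" "A \<le> 1"
    using Acoef_bounds[OF wpos dtpos mpos Lam stab th] by (simp_all add: A_def)
  have position: "((*v) (Mmat th \<omega> dt \<Lambda> m) ^^ k) (vector [t, 0]) $ 1 = (1 + A) / 2 * A ^ (k - 1) * t"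
    for t
  proof -
    have "((*v) (Mmat th \<omega> dt \<Lambda> m) ^^ Suc (k - 1)) (vector [t, 0]) $ 1 = (1 + A) / 2 * A ^ (k - 1) * t"
      unfolding A_def using wpos dtpos by (intro funpow_Mmat_position) simp_all
    then show ?thesis using k by (simp only: Suc_diff_1[OF order.strict_trans[OF zero_less_one k]])
  qed
  have bmn: "\<beta> * (m / real n) > 0" using bpos mpos npos by simp
  have "\<bar>(1 + A) / 2 * A ^ (k - 1)\<bar> \<le> (if A > 0 then A ^ (k - 1) else 1 / 2 * (1 / real (k - 1)))"
    by (rule contraction_factor_le[OF A]) (use k in simp)
  moreover have "0 < (if A > 0 then A ^ (k - 1) else 1 / 2 * (1 / real (k - 1)))" using k by simp
  ultimately show ?thesis
    unfolding th_def[symmetric] A_def[symmetric] by (rule W2_le_cmult) (erule coupling_plaw[OF _ bmn position])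
qed

end
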